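(* Let $n \geq 2$, let $\mathcal{V}$ be a nonempty finite set of points on the unit $n$-sphere centered at the origin in $\mathbb{R}^n$, and let $\mathcal{D}$ be the set of distinct lengths of the chords between them. Suppose further that $\mathcal{V}$ is symmetric about the origin and that the symmetry group of $\mathcal{V}$ acts transitively on $\mathcal{V}$. Then $$\sum_{d \in \mathcal{D}} d^2 = 2k+2,$$ where $k$ is the cardinality of $\mathcal{D}$.
   Context: The unit $n$-sphere centered at the origin is the set of all points in $\mathbb{R}^n$ at Euclidean distance $1$ from the origin. A chord of $\mathcal{V}$ is a line segment joining two distinct points of $\mathcal{V}$; thus $\mathcal{D}=\{\|\mathbf{P}-\mathbf{Q}\| : \mathbf{P},\mathbf{Q}\in\mathcal{V},\ \mathbf{P}\ne\mathbf{Q}\}$, as a set (no multiplicities, and $0\notin\mathcal{D}$). A set $\mathcal{V}$ is symmetric about the origin if for every $\mathbf{P}\in\mathcal{V}$ the point $-\mathbf{P}$ is in $\mathcal{V}$. The symmetry group $G$ of $\mathcal{V}$ is the group of isometries of $\mathbb{R}^n$ mapping $\mathcal{V}$ onto itself; it acts transitively on $\mathcal{V}$ if for every $\mathbf{P},\mathbf{Q}\in\mathcal{V}$ there exists $g\in G$ with $g\mathbf{P}=\mathbf{Q}$. *)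

theory Defs
  imports "HOL-Analysis.Analysis"
begin

definition chord_lengths :: "'a::metric_space set \<Rightarrow> real set" where
  "chord_lengths V = {dist P Q | P Q. P \<in> V \<and> Q \<in> V \<and> P \<noteq> Q}"

definition symmetric_about_origin :: "'a::real_vector set \<Rightarrow> bool" where
  "symmetric_about_origin V \<longleftrightarrow> (\<forall>P\<in>V. - P \<in> V)"

text \<open>The symmetries are isometries of the whole ambient space, so they need not fix the origin;
  the group operation is composition.\<close>

definition symmetry_group :: "'a::metric_space set \<Rightarrow> ('a \<Rightarrow> 'a) set" where
  "symmetry_group V = {g. bij g \<and> (\<forall>x y. dist (g x) (g y) = dist x y) \<and> g ` V = V}"

lemma id_in_symmetry_group: "id \<in> symmetry_group V"
  by (simp add: symmetry_group_def)

lemma comp_in_symmetry_group: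
  assumes "g \<in> symmetry_group V" "h \<in> symmetry_group V"
  shows "g \<circ> h \<in> symmetry_group V"
proof -
  have "(g \<circ> h) ` V = V"
    using assms by (simp only: symmetry_group_def mem_Collect_eq image_comp [symmetric])
  then show ?thesis
    using assms by (simp add: symmetry_group_def bij_comp)
qed

lemma inv_in_symmetry_group:
  assumes "g \<in> symmetry_group V"
  shows "inv g \<in> symmetry_group V"
proof -
  have g: "bij g" "\<And>x y. dist (g x) (g y) = dist x y" "g ` V = V"
    using assms by (auto simp: symmetry_group_def)
  have "dist (inv g x) (inv g y) = dist x y" for x y
    using g(2)[of "inv g x" "inv g y"] g(1) by (simp add: bij_is_surj surj_f_inv_f)
  moreover have "inv g ` V = V"
    using g(1,3) by (metis bij_is_inj image_inv_f_f)
  ultimately show ?thesis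
    using g(1) by (simp add: symmetry_group_def bij_imp_bij_inv)
qed

definition acts_transitively_on :: "('a \<Rightarrow> 'a) set \<Rightarrow> 'a set \<Rightarrow> bool" where
  "acts_transitively_on G V \<longleftrightarrow> (\<forall>P\<in>V. \<forall>Q\<in>V. \<exists>g\<in>G. g P = Q)"

end

theory Submission
  imports Defs
begin

text \<open>Adjoin the degenerate length \<open>0\<close> to the set of chord lengths, obtaining the set \<open>E\<close> of all
  distances between points of \<open>V\<close>. For \<open>P, Q\<close> on the unit sphere, the points \<open>P, Q, -Q\<close> form
  a (possibly degenerate) triangle with a right angle at \<open>P\<close> (Thales), so that
  \<open>\<parallel>P - Q\<parallel>\<^sup>2 + \<parallel>P - (-Q)\<parallel>\<^sup>2 = 4\<close>. As \<open>V\<close> is closed under negation, \<open>d \<mapsto> sqrt (4 - d\<^sup>2)\<close> is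
  therefore an involution of \<open>E\<close> (it exchanges \<open>0\<close> with the diameter \<open>2\<close>). Summing
  \<open>d\<^sup>2 + (4 - d\<^sup>2) = 4\<close> over \<open>E\<close> counts every squared length twice, so the squares of the elements
  of \<open>E\<close> add up to \<open>2 |E|\<close>. Here \<open>|E| = k + 1\<close>, and the additional length \<open>0\<close> contributes
  nothing to the sum.\<close>

text \<open>The Thales relation is the parallelogram law for two unit vectors.\<close>

lemma dist_antipode_squared:
  fixes P Q :: "'a::real_inner"
  assumes "P \<in> sphere 0 1" "Q \<in> sphere 0 1"
  shows "(dist P (- Q))\<^sup>2 = 4 - (dist P Q)\<^sup>2"
proof -
  have "P \<bullet> P = 1" "Q \<bullet> Q = 1"
    using assms by (simp_all add: dot_square_norm)
  then show ?thesis
    by (simp add: dist_norm power2_norm_eq_inner inner_diff inner_add inner_commute)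
qed

lemma insert_zero_chord_lengths:
  assumes "V \<noteq> {}"
  shows "insert 0 (chord_lengths V) = {dist P Q | P Q. P \<in> V \<and> Q \<in> V}"
proof (intro equalityI subsetI)
  fix d assume "d \<in> insert 0 (chord_lengths V)"
  moreover obtain P where "P \<in> V" using assms by blast
  then have "\<exists>P Q. 0 = dist P Q \<and> P \<in> V \<and> Q \<in> V" by (metis dist_self)
  ultimately show "d \<in> {dist P Q | P Q. P \<in> V \<and> Q \<in> V}"
    by (auto simp: chord_lengths_def)
next
  fix d assume "d \<in> {dist P Q | P Q. P \<in> V \<and> Q \<in> V}"
  then show "d \<in> insert 0 (chord_lengths V)"
    by (auto simp: chord_lengths_def)
qed

lemma finite_chord_lengths:
  assumes "finite V"
  shows "finite (chord_lengths V)"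
proof (rule finite_subset)
  show "chord_lengths V \<subseteq> (\<lambda>(P, Q). dist P Q) ` (V \<times> V)"
    by (auto simp: chord_lengths_def)
  show "finite ((\<lambda>(P, Q). dist P Q) ` (V \<times> V))"
    using assms by simp
qed

text \<open>Replacing one end point of a chord by its antipode complements the squared length to \<open>4\<close>.
  Hence the distances pair off as \<open>d\<close> and \<open>sqrt (4 - d\<^sup>2)\<close>, with average square \<open>2\<close>.\<close>

lemma sum_chord_lengths_squared:
  fixes V :: "'a::real_inner set"
  assumes "finite V" "V \<noteq> {}" "V \<subseteq> sphere 0 1" "symmetric_about_origin V"
  shows "(\<Sum>d\<in>chord_lengths V. d\<^sup>2) = 2 * real (card (chord_lengths V)) + 2"
proof -
  let ?E = "insert 0 (chord_lengths V)"
  let ?f = "\<lambda>d::real. sqrt (4 - d\<^sup>2)"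
  have fin: "finite (chord_lengths V)"
    using assms(1) by (rule finite_chord_lengths)
  have zero: "0 \<notin> chord_lengths V"
    by (auto simp: chord_lengths_def)
  have f: "?f d \<in> ?E \<and> (?f d)\<^sup>2 = 4 - d\<^sup>2 \<and> ?f (?f d) = d" if dE: "d \<in> ?E" for d
  proof -
    obtain P Q where PQ: "P \<in> V" "Q \<in> V" "d = dist P Q"
      using dE unfolding insert_zero_chord_lengths[OF assms(2)] by blast
    then have sq: "(dist P (- Q))\<^sup>2 = 4 - d\<^sup>2"
      using assms(3) by (auto intro!: dist_antipode_squared)
    then have fd: "?f d = dist P (- Q)"
      by (intro real_sqrt_unique) auto
    moreover have "- Q \<in> V"
      using assms(4) PQ(2) by (simp add: symmetric_about_origin_def)
    ultimately have "?f d \<in> ?E"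
      unfolding insert_zero_chord_lengths[OF assms(2)] using PQ(1) by blast
    moreover have "?f (dist P (- Q)) = d"
      using PQ(3) by (simp add: sq)
    ultimately show ?thesis
      using fd sq by simp
  qed
  have "(\<Sum>d\<in>?E. d\<^sup>2) = (\<Sum>d\<in>?E. 4 - d\<^sup>2)"
  proof (rule sum.reindex_bij_witness[of _ ?f ?f])
    fix d assume "d \<in> ?E"
    from f[OF this] show "?f (?f d) = d" "?f (?f d) = d" "?f d \<in> ?E" "?f d \<in> ?E"
      and "4 - (?f d)\<^sup>2 = d\<^sup>2"
      by (blast, blast, blast, blast, linarith)
  qed
  also have "\<dots> = 4 * real (card ?E) - (\<Sum>d\<in>?E. d\<^sup>2)"
    by (simp add: sum_subtractf)
  finally show ?thesis
    using fin zero by simp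
qed

theorem theorem3p1:
  fixes V :: "(real ^ 'n) set"
  assumes "CARD('n) \<ge> 2"
    and "finite V"
    and "V \<noteq> {}"
    and "V \<subseteq> sphere 0 1"
    and "symmetric_about_origin V"
    and "acts_transitively_on (symmetry_group V) V"
  shows "(\<Sum>d\<in>chord_lengths V. d\<^sup>2) = 2 * real (card (chord_lengths V)) + 2"
  using assms(2-5) by (rule sum_chord_lengths_squared)

end
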